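(* Let $S$ be a proper restriction semigroup with local units, let $\beta$ be the spectral action of $S$ on $\widehat{P(S)}$ and let $\overline\beta$ be the induced partial action of $S/\sigma$ on $\widehat{P(S)}$. Then $S$ is $(\cdot,{}^* )$-isomorphic to the partial action product $S/\sigma\ltimes_{\overline\beta}\iota(P(S))$ via the map $$\psi\colon S\to S/\sigma\ltimes_{\overline\beta}\iota(P(S)),\qquad s\mapsto([s]_\sigma,D_{s^*}).$$
   Context: **Restriction semigroups.** A restriction semigroup is an algebra $(S;\cdot,{}^* )$ where $(S;\cdot)$ is a semigroup and ${}^*$ is a unary operation with $xx^*=x$, $x^*y^*=y^*x^*=(x^*y^* )^*$, $(xy)^*=(x^*y)^*$, $x^*y=y(xy)^*$. $P(S)=\{s^*:s\in S\}$ is the semilattice of projections ($e\le f\Leftrightarrow e=ef$). $S$ has local units if for every $s$ there are $e,f\in P(S)$ with $es=sf=s$. $\sigma$ is the minimum $(\cdot,{}^* )$-congruence on $S$ identifying all projections; $[s]_\sigma$ is the $\sigma$-class of $s$, and $S/\sigma$ is a monoid with identity the class of projections. $S$ is proper if $s\mathrel\sigma t$ and $s^*=t^*$ imply $s=t$. **Spectrum.** For a semilattice $E$, $\widehat E$ is the set of non-zero semilattice morphisms $E\to\{0,1\}$ with the topology whose basis consists of the sets $D_e=\{\varphi:\varphi(e)=1\}$ and $D_e\setminus(D_{f_1}\cup\dots\cup D_{f_k})$, $f_i\le e$, $k\geq 1$. Put $\iota(E)=\{D_e:e\in E\}$, a meet-subsemilattice of the generalized Boolean algebra of compact-open subsets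 of $\widehat E$, isomorphic to $E$ via $e\mapsto D_e$. **Spectral action and induced partial action.** For $s\in S$, $\beta_s$ is the partial self-map of $\widehat{P(S)}$ with domain $D_{s^*}$ and $\beta_s(\varphi)(e)=\varphi((es)^* )$. For $t\in S/\sigma$, $\mathrm{dom}(\overline\beta_t)=\bigcup_{[s]_\sigma=t}D_{s^*}$ and $\overline\beta_t(\varphi)=\beta_s(\varphi)$ for any $s$ with $[s]_\sigma=t$ and $\varphi\in D_{s^*}$ (well defined since $S$ is proper). **Partial action product.** $\mathcal{PT}(X)$ denotes the monoid of continuous partial self-maps of $X$ with open domains. A partial action of a monoid $T$ on $X$ is a map $\alpha\colon T\to\mathcal{PT}(X)$ with $\alpha_1=\mathrm{id}_X$ and $\alpha_{st}$ extending $\alpha_s\alpha_t$. It is proper with respect to a meet-subsemilattice $\mathcal E$ of compact-open subsets of $X$ if (P1) $\mathrm{dom}(\alpha_t)=\bigcup\{e\in\mathcal E:e\subseteq\mathrm{dom}(\alpha_t)\}$ for all $t\in T$, and (P2) $\alpha_t^{-1}(f)\cap e\in\mathcal E$ for all $t\in T$, $e,f\in\mathcal E$ with $e\subseteq\mathrm{dom}(\alpha_t)$. If $\alpha$ is a partial action of $T$ on $\widehat E$ proper with respect to $\iota(E)$ (as is the case for $\overline\beta$ with $T=S/\sigma$, $E=P(S)$), the partial action product $T\ltimes_\alpha\iota(E)$ is the restriction semigroup of all pairs $(t,D_e)$ with $t\in T$, $e\in E$, $D_e\subseteq\mathrm{dom}(\alpha_t)$, with operations $$(s,D_e)(t,D_f)=(st,\alpha_t^{-1}(D_e)\cap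 D_f),\qquad (s,D_e)^*=(1,D_e).$$ *)

theory Defs
  imports "HOL-Analysis.Analysis" "HOL-Algebra.Group"
begin

section \<open>Restriction semigroups\<close>

record 'a star_semigroup = "'a partial_object" +
  smult :: "['a, 'a] \<Rightarrow> 'a" (infixl \<open>\<cdot>\<index>\<close> 70)
  star :: "'a \<Rightarrow> 'a" (\<open>_\<^sup>\<star>\<index>\<close> [1000] 999)

text \<open>Semigroups are non-empty; this is what makes the quotient by \<open>\<sigma>\<close> below a monoid.\<close>

locale restriction_semigroup =
  fixes S (structure)
  assumes nonempty: "carrier S \<noteq> {}"
    and mult_closed: "\<lbrakk>x \<in> carrier S; y \<in> carrier S\<rbrakk> \<Longrightarrow> x \<cdot> y \<in> carrier S"
    and star_closed: "x \<in> carrier S \<Longrightarrow> x\<^sup>\<star> \<in> carrier S"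
    and assoc: "\<lbrakk>x \<in> carrier S; y \<in> carrier S; z \<in> carrier S\<rbrakk> \<Longrightarrow> (x \<cdot> y) \<cdot> z = x \<cdot> (y \<cdot> z)"
    and mult_star: "x \<in> carrier S \<Longrightarrow> x \<cdot> x\<^sup>\<star> = x"
    and star_comm: "\<lbrakk>x \<in> carrier S; y \<in> carrier S\<rbrakk> \<Longrightarrow> x\<^sup>\<star> \<cdot> y\<^sup>\<star> = y\<^sup>\<star> \<cdot> x\<^sup>\<star>"
    and star_mult_star: "\<lbrakk>x \<in> carrier S; y \<in> carrier S\<rbrakk> \<Longrightarrow> x\<^sup>\<star> \<cdot> y\<^sup>\<star> = (x\<^sup>\<star> \<cdot> y\<^sup>\<star>)\<^sup>\<star>"
    and star_mult: "\<lbrakk>x \<in> carrier S; y \<in> carrier S\<rbrakk> \<Longrightarrow> (x \<cdot> y)\<^sup>\<star> = (x\<^sup>\<star> \<cdot> y)\<^sup>\<star>"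
    and ample: "\<lbrakk>x \<in> carrier S; y \<in> carrier S\<rbrakk> \<Longrightarrow> x\<^sup>\<star> \<cdot> y = y \<cdot> (x \<cdot> y)\<^sup>\<star>"

definition projections :: "('a, 'b) star_semigroup_scheme \<Rightarrow> 'a set" where
  "projections S = star S ` carrier S"

definition has_local_units :: "('a, 'b) star_semigroup_scheme \<Rightarrow> bool" where
  "has_local_units S \<longleftrightarrow>
    (\<forall>s\<in>carrier S. \<exists>e\<in>projections S. \<exists>f\<in>projections S. e \<cdot>\<^bsub>S\<^esub> s = s \<and> s \<cdot>\<^bsub>S\<^esub> f = s)"

definition rs_congruence :: "('a, 'b) star_semigroup_scheme \<Rightarrow> ('a \<times> 'a) set \<Rightarrow> bool" where
  "rs_congruence S r \<longleftrightarrow> equiv (carrier S) r \<and>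
    (\<forall>a b c d. (a, b) \<in> r \<longrightarrow> (c, d) \<in> r \<longrightarrow> (a \<cdot>\<^bsub>S\<^esub> c, b \<cdot>\<^bsub>S\<^esub> d) \<in> r) \<and>
    (\<forall>a b. (a, b) \<in> r \<longrightarrow> (a\<^sup>\<star>\<^bsub>S\<^esub>, b\<^sup>\<star>\<^bsub>S\<^esub>) \<in> r)"

definition rs_sigma :: "('a, 'b) star_semigroup_scheme \<Rightarrow> ('a \<times> 'a) set" where
  "rs_sigma S = \<Inter>{r. rs_congruence S r \<and> projections S \<times> projections S \<subseteq> r}"

definition sigma_class :: "('a, 'b) star_semigroup_scheme \<Rightarrow> 'a \<Rightarrow> 'a set" where
  "sigma_class S s = rs_sigma S `` {s}"

definition sigma_quotient :: "('a, 'b) star_semigroup_scheme \<Rightarrow> 'a set monoid" where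
  "sigma_quotient S =
    \<lparr>carrier = carrier S // rs_sigma S,
     mult = (\<lambda>A B. \<Union>a\<in>A. \<Union>b\<in>B. sigma_class S (a \<cdot>\<^bsub>S\<^esub> b)),
     one = (\<Union>e\<in>projections S. sigma_class S e)\<rparr>"

definition rs_proper :: "('a, 'b) star_semigroup_scheme \<Rightarrow> bool" where
  "rs_proper S \<longleftrightarrow> (\<forall>s\<in>carrier S. \<forall>t\<in>carrier S.
     (s, t) \<in> rs_sigma S \<longrightarrow> s\<^sup>\<star>\<^bsub>S\<^esub> = t\<^sup>\<star>\<^bsub>S\<^esub> \<longrightarrow> s = t)"

definition rs_hom ::
  "('a, 'c) star_semigroup_scheme \<Rightarrow> ('b, 'd) star_semigroup_scheme \<Rightarrow> ('a \<Rightarrow> 'b) set" where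
  "rs_hom S S' = {h \<in> carrier S \<rightarrow> carrier S'.
     (\<forall>x\<in>carrier S. \<forall>y\<in>carrier S. h (x \<cdot>\<^bsub>S\<^esub> y) = h x \<cdot>\<^bsub>S'\<^esub> h y) \<and>
     (\<forall>x\<in>carrier S. h (x\<^sup>\<star>\<^bsub>S\<^esub>) = (h x)\<^sup>\<star>\<^bsub>S'\<^esub>)}"

definition rs_iso ::
  "('a, 'c) star_semigroup_scheme \<Rightarrow> ('b, 'd) star_semigroup_scheme \<Rightarrow> ('a \<Rightarrow> 'b) set" where
  "rs_iso S S' = {h \<in> rs_hom S S'. bij_betw h (carrier S) (carrier S')}"

section \<open>The spectrum of a semilattice\<close>

text \<open>A semilattice is given by its carrier \<open>E\<close> and its meet \<open>m\<close>; the two-element semilattice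
  \<open>{0,1}\<close> is \<^typ>\<open>bool\<close> with conjunction. Functions on \<open>E\<close> are extensional, so that
  equality of characters is equality on \<open>E\<close>.\<close>

definition spectrum :: "'a set \<Rightarrow> ('a \<Rightarrow> 'a \<Rightarrow> 'a) \<Rightarrow> ('a \<Rightarrow> bool) set" where
  "spectrum E m = {\<phi> \<in> extensional E.
     (\<forall>e\<in>E. \<forall>f\<in>E. \<phi> (m e f) \<longleftrightarrow> \<phi> e \<and> \<phi> f) \<and> (\<exists>e\<in>E. \<phi> e)}"

definition cyl :: "'a set \<Rightarrow> ('a \<Rightarrow> 'a \<Rightarrow> 'a) \<Rightarrow> 'a \<Rightarrow> ('a \<Rightarrow> bool) set" where
  "cyl E m e = {\<phi> \<in> spectrum E m. \<phi> e}"

definition spectrum_basis :: "'a set \<Rightarrow> ('a \<Rightarrow> 'a \<Rightarrow> 'a) \<Rightarrow> ('a \<Rightarrow> bool) set set" where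
  "spectrum_basis E m = cyl E m ` E \<union>
     {cyl E m e - (\<Union>f\<in>F. cyl E m f) |e F.
        e \<in> E \<and> finite F \<and> F \<noteq> {} \<and> F \<subseteq> E \<and> (\<forall>f\<in>F. f = m f e)}"

definition spectrum_top :: "'a set \<Rightarrow> ('a \<Rightarrow> 'a \<Rightarrow> 'a) \<Rightarrow> ('a \<Rightarrow> bool) topology" where
  "spectrum_top E m = topology_generated_by (spectrum_basis E m)"

definition iota :: "'a set \<Rightarrow> ('a \<Rightarrow> 'a \<Rightarrow> 'a) \<Rightarrow> ('a \<Rightarrow> bool) set set" where
  "iota E m = cyl E m ` E"

section \<open>Partial actions and partial action products\<close>

definition PT :: "'x topology \<Rightarrow> ('x \<rightharpoonup> 'x) set" where
  "PT X = {f. openin X (dom f) \<and> ran f \<subseteq> topspace X \<and>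
     continuous_map (subtopology X (dom f)) X (\<lambda>x. the (f x))}"

definition partial_action :: "('t, 'b) monoid_scheme \<Rightarrow> 'x topology \<Rightarrow> ('t \<Rightarrow> 'x \<rightharpoonup> 'x) \<Rightarrow> bool" where
  "partial_action T X \<alpha> \<longleftrightarrow> monoid T \<and> (\<forall>t\<in>carrier T. \<alpha> t \<in> PT X) \<and>
     \<alpha> \<one>\<^bsub>T\<^esub> = Some |` topspace X \<and>
     (\<forall>s\<in>carrier T. \<forall>t\<in>carrier T. \<alpha> s \<circ>\<^sub>m \<alpha> t \<subseteq>\<^sub>m \<alpha> (s \<otimes>\<^bsub>T\<^esub> t))"

definition pm_vimage :: "('x \<rightharpoonup> 'y) \<Rightarrow> 'y set \<Rightarrow> 'x set" where
  "pm_vimage f A = {x. \<exists>y\<in>A. f x = Some y}"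

definition proper_action ::
  "('t, 'b) monoid_scheme \<Rightarrow> 'x topology \<Rightarrow> ('t \<Rightarrow> 'x \<rightharpoonup> 'x) \<Rightarrow> 'x set set \<Rightarrow> bool" where
  "proper_action T X \<alpha> \<E> \<longleftrightarrow> partial_action T X \<alpha> \<and>
     (\<forall>U\<in>\<E>. openin X U \<and> compactin X U) \<and> (\<forall>U\<in>\<E>. \<forall>V\<in>\<E>. U \<inter> V \<in> \<E>) \<and>
     (\<forall>t\<in>carrier T. dom (\<alpha> t) = \<Union>{U \<in> \<E>. U \<subseteq> dom (\<alpha> t)}) \<and>
     (\<forall>t\<in>carrier T. \<forall>U\<in>\<E>. \<forall>V\<in>\<E>. U \<subseteq> dom (\<alpha> t) \<longrightarrow> pm_vimage (\<alpha> t) V \<inter> U \<in> \<E>)"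

text \<open>The product is meant for a partial action \<open>\<alpha>\<close> that is proper with respect to \<open>\<E>\<close>.\<close>

definition partial_action_product ::
  "('t, 'b) monoid_scheme \<Rightarrow> ('t \<Rightarrow> 'x \<rightharpoonup> 'x) \<Rightarrow> 'x set set \<Rightarrow> ('t \<times> 'x set) star_semigroup" where
  "partial_action_product T \<alpha> \<E> =
    \<lparr>carrier = {(t, U). t \<in> carrier T \<and> U \<in> \<E> \<and> U \<subseteq> dom (\<alpha> t)},
     smult = (\<lambda>(s, U) (t, V). (s \<otimes>\<^bsub>T\<^esub> t, pm_vimage (\<alpha> t) U \<inter> V)),
     star = (\<lambda>(s, U). (\<one>\<^bsub>T\<^esub>, U))\<rparr>"

section \<open>The spectral action and the induced partial action\<close>

abbreviation proj_D :: "('a, 'b) star_semigroup_scheme \<Rightarrow> 'a \<Rightarrow> ('a \<Rightarrow> bool) set" where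
  "proj_D S \<equiv> cyl (projections S) (smult S)"

definition spectral_action ::
  "('a, 'b) star_semigroup_scheme \<Rightarrow> 'a \<Rightarrow> ('a \<Rightarrow> bool) \<rightharpoonup> ('a \<Rightarrow> bool)" where
  "spectral_action S s =
    (\<lambda>\<phi>. Some (\<lambda>e\<in>projections S. \<phi> ((e \<cdot>\<^bsub>S\<^esub> s)\<^sup>\<star>\<^bsub>S\<^esub>))) |` proj_D S (s\<^sup>\<star>\<^bsub>S\<^esub>)"

text \<open>The choice of \<open>s\<close> does not matter if \<open>S\<close> is proper, see
  \<open>induced_action_eq\<close> below.\<close>

definition induced_action ::
  "('a, 'b) star_semigroup_scheme \<Rightarrow> 'a set \<Rightarrow> ('a \<Rightarrow> bool) \<rightharpoonup> ('a \<Rightarrow> bool)" where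
  "induced_action S t =
    (\<lambda>\<phi>. spectral_action S
       (SOME s. s \<in> carrier S \<and> sigma_class S s = t \<and> \<phi> \<in> proj_D S (s\<^sup>\<star>\<^bsub>S\<^esub>)) \<phi>)
    |` (\<Union>s\<in>{s \<in> carrier S. sigma_class S s = t}. proj_D S (s\<^sup>\<star>\<^bsub>S\<^esub>))"

section \<open>Well-definedness\<close>

text \<open>The induced action does not depend on choices and is a partial action proper with respect to
  \<open>\<iota>(P(S))\<close>, so the partial action product built from it is one in the intended sense.\<close>

lemma topspace_spectrum_top [simp]: "topspace (spectrum_top E m) = spectrum E m"
  by (auto simp: spectrum_top_def spectrum_basis_def cyl_def spectrum_def)

lemma cyl_Int:
  assumes "e \<in> E" "f \<in> E"
  shows "cyl E m e \<inter> cyl E m f = cyl E m (m e f)"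
  using assms by (auto simp: cyl_def spectrum_def)

lemma openin_cyl: "e \<in> E \<Longrightarrow> openin (spectrum_top E m) (cyl E m e)"
  unfolding spectrum_top_def by (rule topology_generated_by_Basis) (auto simp: spectrum_basis_def)

lemma compactin_cyl:
  assumes e: "e \<in> E" and closed: "\<And>x y. x \<in> E \<Longrightarrow> y \<in> E \<Longrightarrow> m x y \<in> E"
  shows "compactin (spectrum_top E m) (cyl E m e)"
proof -
  define Y where "Y = product_topology (\<lambda>_. discrete_topology (UNIV :: bool set)) E"
  have topY: "topspace Y = extensional E"
    by (auto simp: Y_def PiE_def)
  have compY: "compact_space Y"
    by (simp add: Y_def compact_space_product_topology compact_space_discrete_topology)
  have coord: "continuous_map Y (discrete_topology UNIV) (\<lambda>\<phi>. \<phi> x)" if "x \<in> E" for x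
    using that unfolding Y_def by (rule continuous_map_product_projection)
  have clop: "openin Y {\<phi> \<in> topspace Y. \<phi> x \<in> B}" "closedin Y {\<phi> \<in> topspace Y. \<phi> x \<in> B}"
    if "x \<in> E" for x and B :: "bool set"
    using openin_continuous_map_preimage[OF coord[OF that], of B]
      closedin_continuous_map_preimage[OF coord[OF that], of B] by simp_all
  define H where "H = (\<lambda>(x, y). {\<phi> \<in> topspace Y. \<phi> (m x y) \<longleftrightarrow> \<phi> x \<and> \<phi> y})"
  have Hclosed: "closedin Y (H p)" if "p \<in> E \<times> E" for p
  proof -
    obtain x y where p: "p = (x, y)" and x: "x \<in> E" and y: "y \<in> E" using \<open>p \<in> E \<times> E\<close> by auto
    let ?C = "\<lambda>z b. {\<phi> \<in> topspace Y. \<phi> z \<in> {b}}"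
    have "H p = (?C (m x y) True \<inter> (?C x True \<inter> ?C y True)) \<union>
        (?C (m x y) False \<inter> (?C x False \<union> ?C y False))"
      by (auto simp: H_def p)
    also have "closedin Y \<dots>"
      by (intro closedin_Un closedin_Int clop x y closed)
    finally show ?thesis .
  qed
  have cyl_eq: "cyl E m e = {\<phi> \<in> topspace Y. \<phi> e \<in> {True}} \<inter> (\<Inter>p\<in>E \<times> E. H p)"
    using e by (auto simp: cyl_def spectrum_def H_def topY)
  have "closedin Y (cyl E m e)"
    unfolding cyl_eq using Hclosed e by (intro closedin_Int clop closedin_Inter) auto
  then have comp: "compactin Y (cyl E m e)"
    using compY closedin_compact_space by blast
  have sub: "cyl E m e \<subseteq> topspace Y"
    by (auto simp: cyl_eq)
  have cylpre: "openin Y {\<phi> \<in> topspace Y. \<phi> f}" "openin Y {\<phi> \<in> topspace Y. \<not> \<phi> f}"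
    if "f \<in> E" for f
    using clop(1)[OF that, of "{True}"] clop(1)[OF that, of "{False}"] by simp_all
  have "continuous_map (subtopology Y (cyl E m e)) (spectrum_top E m) id"
    unfolding spectrum_top_def
  proof (rule continuous_on_generated_topo)
    fix U assume "U \<in> spectrum_basis E m"
    then consider (1) f where "f \<in> E" "U = cyl E m f"
      | (2) f F where "f \<in> E" "finite F" "F \<noteq> {}" "F \<subseteq> E" "U = cyl E m f - (\<Union>g\<in>F. cyl E m g)"
      unfolding spectrum_basis_def by blast
    then have "\<exists>V. openin Y V \<and> U \<inter> cyl E m e = V \<inter> cyl E m e"
    proof cases
      case 1
      then show ?thesis
        using sub by (intro exI[of _ "{\<phi> \<in> topspace Y. \<phi> f}"]) (auto simp: cylpre cyl_def)
    next
      case 2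
      let ?V = "{\<phi> \<in> topspace Y. \<phi> f} \<inter> (\<Inter>g\<in>F. {\<phi> \<in> topspace Y. \<not> \<phi> g})"
      have "openin Y ?V"
        using 2 by (intro openin_Int openin_INT2 cylpre) auto
      moreover have "U \<inter> cyl E m e = ?V \<inter> cyl E m e"
        using 2 sub by (auto simp: cyl_def)
      ultimately show ?thesis by blast
    qed
    then show "openin (subtopology Y (cyl E m e)) (id -` U \<inter> topspace (subtopology Y (cyl E m e)))"
      using sub by (auto simp: openin_subtopology Int_absorb1 Int_commute)
  next
    show "id ` topspace (subtopology Y (cyl E m e)) \<subseteq> \<Union>(spectrum_basis E m)"
      using e by (auto simp: spectrum_basis_def)
  qed
  moreover have "compactin (subtopology Y (cyl E m e)) (cyl E m e)"
    using comp by (simp add: compactin_subtopology)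
  ultimately have "compactin (spectrum_top E m) (id ` cyl E m e)"
    by (rule image_compactin[rotated])
  then show ?thesis by simp
qed

context restriction_semigroup
begin

abbreviation (input) "PP \<equiv> projections S"
abbreviation (input) "sg \<equiv> rs_sigma S"
abbreviation (input) "Q \<equiv> sigma_quotient S"

lemma star_proj: "x \<in> carrier S \<Longrightarrow> x\<^sup>\<star> \<in> PP"
  by (simp add: projections_def)

lemma star_star: "x \<in> carrier S \<Longrightarrow> (x\<^sup>\<star>)\<^sup>\<star> = x\<^sup>\<star>"
  by (metis mult_star star_closed star_mult star_mult_star)

lemma proj_carrier: "e \<in> PP \<Longrightarrow> e \<in> carrier S"
  by (auto simp: projections_def star_closed)

lemma proj_star: "e \<in> PP \<Longrightarrow> e\<^sup>\<star> = e"
  by (auto simp: projections_def star_star)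

lemma proj_idem: "e \<in> PP \<Longrightarrow> e \<cdot> e = e"
  by (metis mult_star proj_carrier proj_star)

lemma proj_mult: "e \<in> PP \<Longrightarrow> f \<in> PP \<Longrightarrow> e \<cdot> f \<in> PP"
  by (metis proj_carrier proj_star star_mult_star star_proj mult_closed)

lemma proj_comm: "e \<in> PP \<Longrightarrow> f \<in> PP \<Longrightarrow> e \<cdot> f = f \<cdot> e"
  by (metis proj_carrier proj_star star_comm)

lemma star_mult_proj:
  assumes "x \<in> carrier S" "e \<in> PP" shows "(x \<cdot> e)\<^sup>\<star> = x\<^sup>\<star> \<cdot> e"
  by (metis assms proj_carrier proj_star star_mult star_mult_star)

lemma proj_ample:
  assumes "y \<in> carrier S" "e \<in> PP" shows "e \<cdot> y = y \<cdot> (e \<cdot> y)\<^sup>\<star>"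
  by (metis assms proj_carrier proj_star ample)

lemma star_le:
  assumes "x \<in> carrier S" "y \<in> carrier S" shows "(x \<cdot> y)\<^sup>\<star> \<cdot> y\<^sup>\<star> = (x \<cdot> y)\<^sup>\<star>"
  by (metis assms assoc mult_closed mult_star star_closed star_mult_proj star_proj)

lemma proj_nonempty: "PP \<noteq> {}"
  using nonempty by (simp add: projections_def)

lemma sigma_congruence: "rs_congruence S sg" and proj_sigma: "PP \<times> PP \<subseteq> sg"
proof -
  let ?R = "{r. rs_congruence S r \<and> PP \<times> PP \<subseteq> r}"
  have tot: "carrier S \<times> carrier S \<in> ?R"
    using mult_closed star_closed proj_carrier
    by (auto simp: rs_congruence_def equiv_def refl_on_def sym_def trans_def)
  have R: "equiv (carrier S) r" if "r \<in> ?R" for r using that by (auto simp: rs_congruence_def)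
  have "equiv (carrier S) (\<Inter>?R)"
  proof (rule equivI)
    show "\<Inter>?R \<subseteq> carrier S \<times> carrier S" using tot by blast
    show "refl_on (carrier S) (\<Inter>?R)"
      using R by (auto simp: refl_on_def equiv_def)
    show "sym (\<Inter>?R)" using R unfolding sym_def equiv_def by blast
    show "trans (\<Inter>?R)" using R unfolding trans_def equiv_def by blast
  qed
  moreover have "(a \<cdot> c, b \<cdot> d) \<in> \<Inter>?R" if "(a, b) \<in> \<Inter>?R" "(c, d) \<in> \<Inter>?R" for a b c d
    using that unfolding rs_congruence_def by blast
  moreover have "(a\<^sup>\<star>, b\<^sup>\<star>) \<in> \<Inter>?R" if "(a, b) \<in> \<Inter>?R" for a b
    using that unfolding rs_congruence_def by blast
  ultimately show "rs_congruence S sg"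
    unfolding rs_sigma_def by (subst rs_congruence_def) blast
  show "PP \<times> PP \<subseteq> sg" unfolding rs_sigma_def by blast
qed

lemma sigma_equiv: "equiv (carrier S) sg"
  using sigma_congruence by (simp add: rs_congruence_def)

lemma sigma_mult: "(a, b) \<in> sg \<Longrightarrow> (c, d) \<in> sg \<Longrightarrow> (a \<cdot> c, b \<cdot> d) \<in> sg"
  using sigma_congruence unfolding rs_congruence_def by blast

lemma sigma_refl: "a \<in> carrier S \<Longrightarrow> (a, a) \<in> sg"
  using sigma_equiv by (simp add: equiv_def refl_on_def)

lemma sigma_sym: "(a, b) \<in> sg \<Longrightarrow> (b, a) \<in> sg"
  using sigma_equiv by (auto simp: equiv_def sym_def)

lemma sigma_trans: "(a, b) \<in> sg \<Longrightarrow> (b, c) \<in> sg \<Longrightarrow> (a, c) \<in> sg"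
  using sigma_equiv unfolding equiv_def trans_def by blast

lemma sigma_carrier: "(a, b) \<in> sg \<Longrightarrow> a \<in> carrier S \<and> b \<in> carrier S"
  using sigma_equiv by (auto simp: equiv_def)

lemma sigma_mult_proj: "s \<in> carrier S \<Longrightarrow> e \<in> PP \<Longrightarrow> (s \<cdot> e, s) \<in> sg"
  using sigma_mult[OF sigma_refl, of s e "s\<^sup>\<star>"] proj_sigma star_proj mult_star by auto

lemma sigma_proj_mult: "s \<in> carrier S \<Longrightarrow> e \<in> PP \<Longrightarrow> (e \<cdot> s, s) \<in> sg"
  by (metis proj_ample sigma_mult_proj star_proj mult_closed proj_carrier)

lemma class_eq: "a \<in> carrier S \<Longrightarrow> b \<in> carrier S \<Longrightarrow> sigma_class S a = sigma_class S b \<longleftrightarrow> (a, b) \<in> sg"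
  unfolding sigma_class_def by (rule eq_equiv_class_iff[OF sigma_equiv])

lemma class_self: "a \<in> carrier S \<Longrightarrow> a \<in> sigma_class S a"
  by (simp add: sigma_class_def sigma_refl)

lemma quotE:
  assumes "t \<in> carrier Q"
  obtains s where "s \<in> carrier S" "t = sigma_class S s"
  using assms by (auto simp: sigma_quotient_def quotient_def sigma_class_def)

lemma quotI: "s \<in> carrier S \<Longrightarrow> sigma_class S s \<in> carrier Q"
  by (auto simp: sigma_quotient_def quotient_def sigma_class_def)

lemma quot_mult:
  assumes "a \<in> carrier S" "b \<in> carrier S"
  shows "sigma_class S a \<otimes>\<^bsub>Q\<^esub> sigma_class S b = sigma_class S (a \<cdot> b)"
proof -
  have "sigma_class S (a' \<cdot> b') = sigma_class S (a \<cdot> b)"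
    if "a' \<in> sigma_class S a" "b' \<in> sigma_class S b" for a' b'
  proof -
    have "(a \<cdot> b, a' \<cdot> b') \<in> sg" using that by (auto simp: sigma_class_def intro: sigma_mult)
    then show ?thesis
      unfolding sigma_class_def by (rule equiv_class_eq[OF sigma_equiv, symmetric])
  qed
  then show ?thesis
    using class_self[OF assms(1)] class_self[OF assms(2)]
    unfolding sigma_quotient_def monoid.simps by blast
qed

lemma quot_one: "e \<in> PP \<Longrightarrow> \<one>\<^bsub>Q\<^esub> = sigma_class S e"
proof -
  assume e: "e \<in> PP"
  have "sigma_class S f = sigma_class S e" if "f \<in> PP" for f
    using e that proj_sigma by (auto simp: class_eq proj_carrier)
  then show ?thesis using e unfolding sigma_quotient_def monoid.simps by blast
qed

lemma quot_monoid: "monoid Q"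
proof -
  obtain e where e: "e \<in> PP" using proj_nonempty by blast
  show ?thesis
  proof (rule monoidI)
    fix x y assume x: "x \<in> carrier Q" and y: "y \<in> carrier Q"
    show "x \<otimes>\<^bsub>Q\<^esub> y \<in> carrier Q"
      by (rule quotE[OF x], rule quotE[OF y]) (simp add: quot_mult quotI mult_closed)
  next
    show "\<one>\<^bsub>Q\<^esub> \<in> carrier Q" by (simp add: quot_one[OF e] quotI proj_carrier e)
  next
    fix x y z assume x: "x \<in> carrier Q" and y: "y \<in> carrier Q" and z: "z \<in> carrier Q"
    show "x \<otimes>\<^bsub>Q\<^esub> y \<otimes>\<^bsub>Q\<^esub> z = x \<otimes>\<^bsub>Q\<^esub> (y \<otimes>\<^bsub>Q\<^esub> z)"
      by (rule quotE[OF x], rule quotE[OF y], rule quotE[OF z])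
        (simp add: quot_mult mult_closed assoc)
  next
    fix x assume x: "x \<in> carrier Q"
    then obtain s where s: "s \<in> carrier S" "x = sigma_class S s" by (rule quotE)
    show "\<one>\<^bsub>Q\<^esub> \<otimes>\<^bsub>Q\<^esub> x = x"
      using s e by (simp add: quot_one[OF e] quot_mult proj_carrier class_eq mult_closed sigma_proj_mult)
    show "x \<otimes>\<^bsub>Q\<^esub> \<one>\<^bsub>Q\<^esub> = x"
      using s e by (simp add: quot_one[OF e] quot_mult proj_carrier class_eq mult_closed sigma_mult_proj)
  qed
qed

lemma spectral_action_apply:
  "\<phi> \<in> proj_D S (s\<^sup>\<star>) \<Longrightarrow> spectral_action S s \<phi> = Some (\<lambda>e\<in>PP. \<phi> ((e \<cdot> s)\<^sup>\<star>))"
  by (simp add: spectral_action_def)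

lemma character_mult:
  assumes "\<phi> \<in> spectrum PP (smult S)" "e \<in> PP" "f \<in> PP"
  shows "\<phi> (e \<cdot> f) \<longleftrightarrow> \<phi> e \<and> \<phi> f"
  using assms by (auto simp: spectrum_def)

lemma star_conj:
  assumes s: "s \<in> carrier S" and e: "e \<in> PP" and f: "f \<in> PP"
  shows "((e \<cdot> f) \<cdot> s)\<^sup>\<star> = (e \<cdot> s)\<^sup>\<star> \<cdot> (f \<cdot> s)\<^sup>\<star>"
proof -
  have "(e \<cdot> f) \<cdot> s = e \<cdot> (s \<cdot> (f \<cdot> s)\<^sup>\<star>)"
    using s e f by (metis assoc proj_carrier proj_ample)
  also have "\<dots> = (e \<cdot> s) \<cdot> (f \<cdot> s)\<^sup>\<star>"
    using s e f by (simp add: assoc proj_carrier mult_closed star_closed)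
  finally show ?thesis
    using s e f by (simp add: star_mult_proj proj_carrier mult_closed star_proj)
qed

lemma spectral_action_spectrum:
  assumes lu: "has_local_units S" and s: "s \<in> carrier S" and \<phi>: "\<phi> \<in> proj_D S (s\<^sup>\<star>)"
  shows "(\<lambda>e\<in>PP. \<phi> ((e \<cdot> s)\<^sup>\<star>)) \<in> spectrum PP (smult S)"
proof -
  have \<phi>': "\<phi> \<in> spectrum PP (smult S)" "\<phi> (s\<^sup>\<star>)" using \<phi> by (auto simp: cyl_def)
  obtain e where "e \<in> PP" "e \<cdot> s = s" using lu s by (auto simp: has_local_units_def)
  then have "\<exists>e\<in>PP. \<phi> ((e \<cdot> s)\<^sup>\<star>)" using \<phi>'(2) by metis
  moreover have "\<phi> (((e \<cdot> f) \<cdot> s)\<^sup>\<star>) \<longleftrightarrow> \<phi> ((e \<cdot> s)\<^sup>\<star>) \<and> \<phi> ((f \<cdot> s)\<^sup>\<star>)" if "e \<in> PP" "f \<in> PP" for e f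
    using that s by (simp add: star_conj character_mult[OF \<phi>'(1)] star_proj mult_closed proj_carrier)
  ultimately show ?thesis
    by (auto simp: spectrum_def proj_mult)
qed

lemma proper_swap:
  assumes "rs_proper S" "(s, t) \<in> sg"
  shows "s \<cdot> t\<^sup>\<star> = t \<cdot> s\<^sup>\<star>"
proof -
  have st: "s \<in> carrier S" "t \<in> carrier S" using assms(2) sigma_carrier by auto
  have "(s \<cdot> t\<^sup>\<star>)\<^sup>\<star> = (t \<cdot> s\<^sup>\<star>)\<^sup>\<star>"
    using st by (simp add: star_mult_proj star_proj star_comm)
  moreover have "(s \<cdot> t\<^sup>\<star>, t \<cdot> s\<^sup>\<star>) \<in> sg"
    using st assms(2) by (meson sigma_mult_proj sigma_sym sigma_trans star_proj)
  ultimately show ?thesis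
    using assms(1) st by (simp add: rs_proper_def mult_closed star_closed)
qed

lemma spectral_action_cong:
  assumes pr: "rs_proper S" and "(s, t) \<in> sg" and "\<phi> \<in> proj_D S (s\<^sup>\<star>)" "\<phi> \<in> proj_D S (t\<^sup>\<star>)"
  shows "spectral_action S s \<phi> = spectral_action S t \<phi>"
proof -
  have st: "s \<in> carrier S" "t \<in> carrier S" using assms(2) sigma_carrier by auto
  have \<phi>: "\<phi> \<in> spectrum PP (smult S)" "\<phi> (s\<^sup>\<star>)" "\<phi> (t\<^sup>\<star>)" using assms(3,4) by (auto simp: cyl_def)
  have *: "\<phi> ((e \<cdot> u)\<^sup>\<star>) \<longleftrightarrow> \<phi> ((e \<cdot> (u \<cdot> v\<^sup>\<star>))\<^sup>\<star>)"
    if "e \<in> PP" "u \<in> carrier S" "v \<in> carrier S" "\<phi> (v\<^sup>\<star>)" for e u v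
  proof -
    have "(e \<cdot> (u \<cdot> v\<^sup>\<star>))\<^sup>\<star> = (e \<cdot> u)\<^sup>\<star> \<cdot> v\<^sup>\<star>"
      using that by (simp add: assoc[symmetric] star_mult_proj proj_carrier mult_closed star_closed star_proj)
    then show ?thesis
      using that by (simp add: character_mult[OF \<phi>(1)] star_proj mult_closed proj_carrier)
  qed
  have "\<phi> ((e \<cdot> s)\<^sup>\<star>) \<longleftrightarrow> \<phi> ((e \<cdot> t)\<^sup>\<star>)" if "e \<in> PP" for e
    using *[OF that st(1,2) \<phi>(3)] *[OF that st(2,1) \<phi>(2)] proper_swap[OF pr assms(2)] by simp
  then show ?thesis
    using assms(3,4) by (auto simp: spectral_action_apply restrict_def fun_eq_iff)
qed

lemma dom_spectral_action: "dom (spectral_action S s) = proj_D S (s\<^sup>\<star>)"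
  by (auto simp: spectral_action_def restrict_map_def dom_def)

lemma dom_induced_action:
  "dom (induced_action S t) = (\<Union>s\<in>{s \<in> carrier S. sigma_class S s = t}. proj_D S (s\<^sup>\<star>))"
proof (rule Set.set_eqI)
  fix \<phi>
  let ?D = "\<Union>s\<in>{s \<in> carrier S. sigma_class S s = t}. proj_D S (s\<^sup>\<star>)"
  let ?s = "SOME s. s \<in> carrier S \<and> sigma_class S s = t \<and> \<phi> \<in> proj_D S (s\<^sup>\<star>)"
  show "\<phi> \<in> dom (induced_action S t) \<longleftrightarrow> \<phi> \<in> ?D"
  proof (cases "\<phi> \<in> ?D")
    case True
    then have "\<phi> \<in> proj_D S (?s\<^sup>\<star>)"
      using someI_ex[of "\<lambda>s. s \<in> carrier S \<and> sigma_class S s = t \<and> \<phi> \<in> proj_D S (s\<^sup>\<star>)"] by auto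
    then show ?thesis using True by (simp add: induced_action_def dom_def spectral_action_apply)
  next
    case False
    then have "induced_action S t \<phi> = None" unfolding induced_action_def by (rule restrict_out)
    then show ?thesis using False by (simp add: domIff)
  qed
qed

lemma induced_action_eq:
  assumes pr: "rs_proper S" and s: "s \<in> carrier S" and t: "sigma_class S s = t"
    and \<phi>: "\<phi> \<in> proj_D S (s\<^sup>\<star>)"
  shows "induced_action S t \<phi> = spectral_action S s \<phi>"
proof -
  let ?P = "\<lambda>s. s \<in> carrier S \<and> sigma_class S s = t \<and> \<phi> \<in> proj_D S (s\<^sup>\<star>)"
  have P: "?P (SOME s. ?P s)" by (rule someI[of ?P s]) (simp add: s t \<phi>)
  then have "((SOME s. ?P s), s) \<in> sg" using s t class_eq by blast
  then have "spectral_action S (SOME s. ?P s) \<phi> = spectral_action S s \<phi>"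
    using P \<phi> by (intro spectral_action_cong[OF pr]) auto
  then show ?thesis using s t \<phi> by (auto simp: induced_action_def restrict_map_def)
qed

lemma induced_action_Some:
  assumes "rs_proper S" "induced_action S t \<phi> = Some \<psi>"
  obtains s where "s \<in> carrier S" "sigma_class S s = t" "\<phi> \<in> proj_D S (s\<^sup>\<star>)"
    "\<psi> = (\<lambda>e\<in>PP. \<phi> ((e \<cdot> s)\<^sup>\<star>))"
proof -
  have "\<phi> \<in> dom (induced_action S t)" using assms(2) by auto
  then obtain s where s: "s \<in> carrier S" "sigma_class S s = t" "\<phi> \<in> proj_D S (s\<^sup>\<star>)"
    unfolding dom_induced_action by auto
  then show ?thesis
    using that assms(2) induced_action_eq[OF assms(1) s] by (simp add: spectral_action_apply)
qed

text \<open>A principal filter is a character; hence \<open>D\<^sub>e\<close> is covered by a family of sets \<open>D\<^sub>f\<close> only if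
  it is contained in one of them.\<close>

lemma proj_D_subset_UN:
  assumes e: "e \<in> PP" and F: "F \<subseteq> PP" and sub: "proj_D S e \<subseteq> (\<Union>f\<in>F. proj_D S f)"
  obtains f where "f \<in> F" "e \<cdot> f = e"
proof -
  define \<phi> where "\<phi> = (\<lambda>x\<in>PP. e \<cdot> x = e)"
  have "e \<cdot> (x \<cdot> y) = e \<longleftrightarrow> e \<cdot> x = e \<and> e \<cdot> y = e" if "x \<in> PP" "y \<in> PP" for x y
    using e that by (metis assoc proj_carrier proj_comm proj_idem mult_closed)
  then have "\<phi> \<in> proj_D S e"
    using e proj_idem[OF e] by (auto simp: cyl_def spectrum_def \<phi>_def proj_mult)
  then obtain f where "f \<in> F" "\<phi> f" using sub by (auto simp: cyl_def)
  then show ?thesis using that F by (auto simp: \<phi>_def)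
qed

lemma induced_action_PT:
  assumes pr: "rs_proper S" and lu: "has_local_units S"
  shows "induced_action S t \<in> PT (spectrum_top PP (smult S))"
proof -
  let ?X = "spectrum_top PP (smult S)" and ?a = "induced_action S t"
  have op: "openin ?X (dom ?a)"
    unfolding dom_induced_action by (intro openin_Union) (auto simp: openin_cyl star_proj)
  have ran: "ran ?a \<subseteq> spectrum PP (smult S)"
    using spectral_action_spectrum[OF lu] by (auto simp: ran_def elim!: induced_action_Some[OF pr])
  have pre: "pm_vimage (spectral_action S s) U \<inter> proj_D S (s\<^sup>\<star>) = U'"
    if "s \<in> carrier S" "U' = {\<phi> \<in> proj_D S (s\<^sup>\<star>). (\<lambda>e\<in>PP. \<phi> ((e \<cdot> s)\<^sup>\<star>)) \<in> U}" for s U U'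
    using that by (auto simp: pm_vimage_def spectral_action_def)
  have cov: "openin ?X {\<phi> \<in> proj_D S (s\<^sup>\<star>). (\<lambda>e\<in>PP. \<phi> ((e \<cdot> s)\<^sup>\<star>)) \<in> U}"
    if s: "s \<in> carrier S" and U: "U \<in> spectrum_basis PP (smult S)" for s U
  proof -
    have mem: "(\<lambda>e\<in>PP. \<phi> ((e \<cdot> s)\<^sup>\<star>)) \<in> proj_D S f \<longleftrightarrow> \<phi> ((f \<cdot> s)\<^sup>\<star>)"
      if "f \<in> PP" "\<phi> \<in> proj_D S (s\<^sup>\<star>)" for f \<phi>
      using that spectral_action_spectrum[OF lu s] by (simp add: cyl_def)
    have opf: "openin ?X {\<phi> \<in> proj_D S (s\<^sup>\<star>). \<phi> ((f \<cdot> s)\<^sup>\<star>)}"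
       and opnf: "openin ?X {\<phi> \<in> proj_D S (s\<^sup>\<star>). \<not> \<phi> ((f \<cdot> s)\<^sup>\<star>)}" if f: "f \<in> PP" for f
    proof -
      have p: "(f \<cdot> s)\<^sup>\<star> \<in> PP" "s\<^sup>\<star> \<in> PP" using f s by (auto simp: star_proj mult_closed proj_carrier)
      have "{\<phi> \<in> proj_D S (s\<^sup>\<star>). \<phi> ((f \<cdot> s)\<^sup>\<star>)} = proj_D S (s\<^sup>\<star>) \<inter> proj_D S ((f \<cdot> s)\<^sup>\<star>)"
        by (auto simp: cyl_def)
      then show "openin ?X {\<phi> \<in> proj_D S (s\<^sup>\<star>). \<phi> ((f \<cdot> s)\<^sup>\<star>)}"
        using p by (auto intro: openin_Int openin_cyl)
      have "(f \<cdot> s)\<^sup>\<star> = (f \<cdot> s)\<^sup>\<star> \<cdot> s\<^sup>\<star>" using f s by (simp add: star_le proj_carrier)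
      then have "proj_D S (s\<^sup>\<star>) - (\<Union>g\<in>{(f \<cdot> s)\<^sup>\<star>}. proj_D S g) \<in> spectrum_basis PP (smult S)"
        unfolding spectrum_basis_def using p by blast
      then have "openin ?X (proj_D S (s\<^sup>\<star>) - (\<Union>g\<in>{(f \<cdot> s)\<^sup>\<star>}. proj_D S g))"
        unfolding spectrum_top_def by (rule topology_generated_by_Basis)
      moreover have "{\<phi> \<in> proj_D S (s\<^sup>\<star>). \<not> \<phi> ((f \<cdot> s)\<^sup>\<star>)} = proj_D S (s\<^sup>\<star>) - (\<Union>g\<in>{(f \<cdot> s)\<^sup>\<star>}. proj_D S g)"
        by (auto simp: cyl_def)
      ultimately show "openin ?X {\<phi> \<in> proj_D S (s\<^sup>\<star>). \<not> \<phi> ((f \<cdot> s)\<^sup>\<star>)}" by simp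
    qed
    from U consider (1) f where "f \<in> PP" "U = proj_D S f"
      | (2) f F where "f \<in> PP" "finite F" "F \<noteq> {}" "F \<subseteq> PP" "U = proj_D S f - (\<Union>g\<in>F. proj_D S g)"
      unfolding spectrum_basis_def by blast
    then show ?thesis
    proof cases
      case 1
      then have "{\<phi> \<in> proj_D S (s\<^sup>\<star>). (\<lambda>e\<in>PP. \<phi> ((e \<cdot> s)\<^sup>\<star>)) \<in> U} =
          {\<phi> \<in> proj_D S (s\<^sup>\<star>). \<phi> ((f \<cdot> s)\<^sup>\<star>)}"
        using mem by auto
      then show ?thesis using opf 1 by simp
    next
      case 2
      then have "{\<phi> \<in> proj_D S (s\<^sup>\<star>). (\<lambda>e\<in>PP. \<phi> ((e \<cdot> s)\<^sup>\<star>)) \<in> U} =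
          {\<phi> \<in> proj_D S (s\<^sup>\<star>). \<phi> ((f \<cdot> s)\<^sup>\<star>)} \<inter>
          (\<Inter>g\<in>F. {\<phi> \<in> proj_D S (s\<^sup>\<star>). \<not> \<phi> ((g \<cdot> s)\<^sup>\<star>)})"
        using mem by (auto simp: subset_iff)
      also have "openin ?X \<dots>"
        using 2 by (intro openin_Int openin_INT2 opf opnf) auto
      finally show ?thesis .
    qed
  qed
  have "continuous_map (subtopology ?X (dom ?a)) ?X (\<lambda>x. the (?a x))"
    unfolding spectrum_top_def[of _ "smult S"]
  proof (rule continuous_on_generated_topo, fold spectrum_top_def)
    fix U assume U: "U \<in> spectrum_basis PP (smult S)"
    have dsub: "dom ?a \<subseteq> topspace ?X" using op openin_subset by blast
    have "(\<lambda>x. the (?a x)) -` U \<inter> dom ?a =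
        (\<Union>s\<in>{s \<in> carrier S. sigma_class S s = t}. {\<phi> \<in> proj_D S (s\<^sup>\<star>). (\<lambda>e\<in>PP. \<phi> ((e \<cdot> s)\<^sup>\<star>)) \<in> U})"
      by (auto simp: dom_induced_action induced_action_eq[OF pr] spectral_action_apply)
    moreover have "openin ?X \<dots>" using cov U by (intro openin_Union) auto
    ultimately have "openin ?X ((\<lambda>x. the (?a x)) -` U \<inter> dom ?a)" by simp
    then show "openin (subtopology ?X (dom ?a)) ((\<lambda>x. the (?a x)) -` U \<inter> topspace (subtopology ?X (dom ?a)))"
      using dsub by (simp add: openin_open_subtopology[OF op] Int_absorb1)
  next
    show "(\<lambda>x. the (?a x)) ` topspace (subtopology ?X (dom ?a)) \<subseteq> \<Union>(spectrum_basis PP (smult S))"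
    proof -
      have "\<Union>(spectrum_basis PP (smult S)) = spectrum PP (smult S)"
        using topspace_spectrum_top[of PP "smult S"] by (simp add: spectrum_top_def)
      then show ?thesis using ran by (auto simp: ran_def)
    qed
  qed
  then show ?thesis using op ran by (simp add: PT_def)
qed

lemma partial_action_induced:
  assumes pr: "rs_proper S" and lu: "has_local_units S"
  shows "partial_action Q (spectrum_top PP (smult S)) (induced_action S)"
  unfolding partial_action_def
proof (intro conjI ballI)
  show "monoid Q" by (rule quot_monoid)
  show "induced_action S t \<in> PT (spectrum_top PP (smult S))" for t
    by (rule induced_action_PT[OF pr lu])
  show "induced_action S \<one>\<^bsub>Q\<^esub> = Some |` topspace (spectrum_top PP (smult S))"
  proof
    fix \<phi>
    show "induced_action S \<one>\<^bsub>Q\<^esub> \<phi> = (Some |` topspace (spectrum_top PP (smult S))) \<phi>"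
    proof (cases "\<phi> \<in> spectrum PP (smult S)")
      case True
      then obtain e where e: "e \<in> PP" "\<phi> e" by (auto simp: spectrum_def)
      then have "\<phi> \<in> proj_D S (e\<^sup>\<star>)" using True by (simp add: cyl_def proj_star)
      then have "induced_action S \<one>\<^bsub>Q\<^esub> \<phi> = Some (\<lambda>f\<in>PP. \<phi> ((f \<cdot> e)\<^sup>\<star>))"
        unfolding quot_one[OF e(1)] using e
        by (subst induced_action_eq[OF pr, of e]) (simp_all add: proj_carrier spectral_action_apply)
      also have "(\<lambda>f\<in>PP. \<phi> ((f \<cdot> e)\<^sup>\<star>)) = \<phi>"
        using True e by (intro ext) (auto simp: spectrum_def proj_star proj_mult extensional_def)
      finally show ?thesis using True by simp
    next
      case False
      then have "\<phi> \<notin> dom (induced_action S \<one>\<^bsub>Q\<^esub>)" by (auto simp: dom_induced_action cyl_def)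
      then show ?thesis using False by (simp add: domIff)
    qed
  qed
  fix s t assume s: "s \<in> carrier Q" and t: "t \<in> carrier Q"
  show "induced_action S s \<circ>\<^sub>m induced_action S t \<subseteq>\<^sub>m induced_action S (s \<otimes>\<^bsub>Q\<^esub> t)"
    unfolding map_le_def
  proof
    fix \<phi> assume "\<phi> \<in> dom (induced_action S s \<circ>\<^sub>m induced_action S t)"
    then obtain \<psi> \<theta> where 1: "induced_action S t \<phi> = Some \<psi>" and 2: "induced_action S s \<psi> = Some \<theta>"
      by (auto simp: map_comp_def split: option.splits)
    obtain b where b: "b \<in> carrier S" "sigma_class S b = t" "\<phi> \<in> proj_D S (b\<^sup>\<star>)"
      "\<psi> = (\<lambda>e\<in>PP. \<phi> ((e \<cdot> b)\<^sup>\<star>))" using 1 by (rule induced_action_Some[OF pr])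
    obtain a where a: "a \<in> carrier S" "sigma_class S a = s" "\<psi> \<in> proj_D S (a\<^sup>\<star>)"
      "\<theta> = (\<lambda>e\<in>PP. \<psi> ((e \<cdot> a)\<^sup>\<star>))" using 2 by (rule induced_action_Some[OF pr])
    have "\<phi> ((a\<^sup>\<star> \<cdot> b)\<^sup>\<star>)" using a b by (auto simp: cyl_def star_proj)
    then have "\<phi> \<in> proj_D S ((a \<cdot> b)\<^sup>\<star>)"
      using a b star_mult[of a b] by (simp add: cyl_def)
    then have "induced_action S (s \<otimes>\<^bsub>Q\<^esub> t) \<phi> = Some (\<lambda>e\<in>PP. \<phi> ((e \<cdot> (a \<cdot> b))\<^sup>\<star>))"
      using a b by (subst induced_action_eq[OF pr, of "a \<cdot> b"])
        (auto simp: mult_closed quot_mult spectral_action_apply)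
    also have "(\<lambda>e\<in>PP. \<phi> ((e \<cdot> (a \<cdot> b))\<^sup>\<star>)) = \<theta>"
    proof
      fix e
      show "(\<lambda>e\<in>PP. \<phi> ((e \<cdot> (a \<cdot> b))\<^sup>\<star>)) e = \<theta> e"
        using a(1,4) b(1,4) star_mult[of "e \<cdot> a" b]
        by (cases "e \<in> PP") (simp_all add: star_proj mult_closed proj_carrier assoc)
    qed
    finally show "(induced_action S s \<circ>\<^sub>m induced_action S t) \<phi> = induced_action S (s \<otimes>\<^bsub>Q\<^esub> t) \<phi>"
      using 1 2 by (simp add: map_comp_def)
  qed
qed

theorem proper_action_induced:
  assumes pr: "rs_proper S" and lu: "has_local_units S"
  shows "proper_action Q (spectrum_top PP (smult S)) (induced_action S) (iota PP (smult S))"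
  unfolding proper_action_def
proof (intro conjI ballI impI)
  let ?X = "spectrum_top PP (smult S)"
  show "partial_action Q ?X (induced_action S)" by (rule partial_action_induced[OF pr lu])
  show "openin ?X U" "compactin ?X U" if "U \<in> iota PP (smult S)" for U
    using that by (auto simp: iota_def openin_cyl compactin_cyl proj_mult)
  show "U \<inter> V \<in> iota PP (smult S)" if "U \<in> iota PP (smult S)" "V \<in> iota PP (smult S)" for U V
    using that by (auto simp: iota_def cyl_Int proj_mult)
  show "dom (induced_action S t) = \<Union>{U \<in> iota PP (smult S). U \<subseteq> dom (induced_action S t)}" for t
  proof (rule equalityI[OF subsetI], unfold Union_iff)
    fix \<phi> assume "\<phi> \<in> dom (induced_action S t)"
    then obtain s where s: "s \<in> carrier S" "sigma_class S s = t" "\<phi> \<in> proj_D S (s\<^sup>\<star>)"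
      by (auto simp: dom_induced_action)
    then have "proj_D S (s\<^sup>\<star>) \<in> {U \<in> iota PP (smult S). U \<subseteq> dom (induced_action S t)}"
      unfolding dom_induced_action by (auto simp: iota_def star_proj)
    then show "\<exists>U\<in>{U \<in> iota PP (smult S). U \<subseteq> dom (induced_action S t)}. \<phi> \<in> U" using s by blast
  qed auto
  fix t U V assume "t \<in> carrier Q" "U \<in> iota PP (smult S)" "V \<in> iota PP (smult S)"
    and sub: "U \<subseteq> dom (induced_action S t)"
  then obtain e f where e: "e \<in> PP" "U = proj_D S e" and f: "f \<in> PP" "V = proj_D S f"
    by (auto simp: iota_def)
  let ?F = "star S ` {s \<in> carrier S. sigma_class S s = t}"
  have "proj_D S e \<subseteq> (\<Union>f\<in>?F. proj_D S f)"
    using sub e by (simp add: dom_induced_action)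
  then obtain g where "g \<in> ?F" "e \<cdot> g = e"
    using e by (rule_tac proj_D_subset_UN[of e ?F]) (auto simp: star_proj)
  then obtain s where s: "s \<in> carrier S" "sigma_class S s = t" "e \<cdot> s\<^sup>\<star> = e" by blast
  have se: "(f \<cdot> s)\<^sup>\<star> \<cdot> e \<in> PP"
    using e f s by (simp add: proj_mult star_proj mult_closed proj_carrier)
  have in_s: "\<phi> \<in> proj_D S (s\<^sup>\<star>)" if "\<phi> \<in> U" for \<phi>
    using that e s cyl_Int[of e PP "s\<^sup>\<star>" "smult S"] by (auto simp: star_proj)
  have "pm_vimage (induced_action S t) V \<inter> U = proj_D S ((f \<cdot> s)\<^sup>\<star>) \<inter> proj_D S e"
  proof (rule Set.set_eqI)
    fix \<phi>
    show "\<phi> \<in> pm_vimage (induced_action S t) V \<inter> U \<longleftrightarrow> \<phi> \<in> proj_D S ((f \<cdot> s)\<^sup>\<star>) \<inter> proj_D S e"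
    proof (cases "\<phi> \<in> U")
      case True
      note in_s[OF True]
      then have "induced_action S t \<phi> = Some (\<lambda>e\<in>PP. \<phi> ((e \<cdot> s)\<^sup>\<star>))"
        using s by (simp add: induced_action_eq[OF pr] spectral_action_apply)
      then show ?thesis
        using True e f spectral_action_spectrum[OF lu s(1) in_s[OF True]]
        by (auto simp: pm_vimage_def cyl_def)
    qed (simp add: e)
  qed
  also have "\<dots> = proj_D S ((f \<cdot> s)\<^sup>\<star> \<cdot> e)"
    using e f s by (intro cyl_Int) (auto simp: star_proj mult_closed proj_carrier)
  finally show "pm_vimage (induced_action S t) V \<inter> U \<in> iota PP (smult S)"
    using se by (auto simp: iota_def)
qed

end

end

theory Submission
  imports Defs
begin

text \<open>The set \<open>D\<^sub>e\<close> contains the character of the principal filter of \<open>e\<close>, so \<open>e\<close> can be recovered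
  from \<open>D\<^sub>e\<close>; together with properness this makes \<open>\<psi>\<close> injective. The domain of the
  action of \<open>t\<close> is the union of the sets \<open>D\<close> of \<open>s\<^sup>\<star>\<close> over the members \<open>s\<close> of \<open>t\<close>, so the same character
  shows that \<open>D\<^sub>e\<close> lies in it only if \<open>e \<le> s\<^sup>\<star>\<close> for a single such \<open>s\<close>; then \<open>s \<cdot> e\<close> is a preimage
  of \<open>(t, D\<^sub>e)\<close>. Multiplicativity is the identity \<open>(x \<cdot> y)\<^sup>\<star> = (x\<^sup>\<star> \<cdot> y)\<^sup>\<star>\<close> read in the spectrum.\<close>

context restriction_semigroup
begin

text \<open>The inclusion is a cover by the single set \<open>proj_D S f\<close>, so
  \<open>proj_D_subset_UN\<close> applies; conversely, products of projections become
  intersections.\<close>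

lemma proj_D_mono_iff:
  assumes e: "e \<in> PP" and f: "f \<in> PP"
  shows "proj_D S e \<subseteq> proj_D S f \<longleftrightarrow> e \<cdot> f = e"
proof
  assume "proj_D S e \<subseteq> proj_D S f"
  then show "e \<cdot> f = e"
    using proj_D_subset_UN[OF e, of "{f}"] f by auto
next
  assume "e \<cdot> f = e"
  then show "proj_D S e \<subseteq> proj_D S f"
    using cyl_Int[OF e f, of "smult S"] by auto
qed

lemma inj_on_proj_D: "inj_on (proj_D S) PP"
proof (rule inj_onI)
  fix e f assume e: "e \<in> PP" and f: "f \<in> PP" and "proj_D S e = proj_D S f"
  then have "e \<cdot> f = e" "f \<cdot> e = f"
    by (simp_all flip: proj_D_mono_iff)
  then show "e = f" using proj_comm[OF e f] by simp
qed

lemma proj_D_subset_dom: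
  assumes e: "e \<in> PP" and sub: "proj_D S e \<subseteq> dom (induced_action S t)"
  obtains s where "s \<in> carrier S" "sigma_class S s = t" "e \<cdot> s\<^sup>\<star> = e"
proof -
  let ?F = "star S ` {s \<in> carrier S. sigma_class S s = t}"
  have "proj_D S e \<subseteq> (\<Union>f\<in>?F. proj_D S f)"
    using sub by (simp add: dom_induced_action)
  moreover have "?F \<subseteq> PP" by (auto simp: star_proj)
  ultimately obtain g where "g \<in> ?F" "e \<cdot> g = e"
    using proj_D_subset_UN[OF e] by blast
  then show ?thesis using that by blast
qed

text \<open>On the domain of \<open>spectral_action S s\<close> the induced action of the class of
  \<open>s\<close> agrees with it, so the image of \<phi> takes at \<open>f\<close> the value of
  \<phi> at the star of \<open>f \<cdot> s\<close>. That projection lies below the star of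
  \<open>s\<close>, so intersecting loses nothing.\<close>

lemma vimage_induced_action:
  assumes pr: "rs_proper S" and lu: "has_local_units S"
    and s: "s \<in> carrier S" and f: "f \<in> PP"
  shows "pm_vimage (induced_action S (sigma_class S s)) (proj_D S f) \<inter> proj_D S (s\<^sup>\<star>)
    = proj_D S ((f \<cdot> s)\<^sup>\<star>)"
proof -
  have fs: "(f \<cdot> s)\<^sup>\<star> \<in> PP" "s\<^sup>\<star> \<in> PP"
    using s f by (simp_all add: star_proj mult_closed proj_carrier)
  have sub: "proj_D S ((f \<cdot> s)\<^sup>\<star>) \<subseteq> proj_D S (s\<^sup>\<star>)"
    using fs s f by (simp add: proj_D_mono_iff star_le proj_carrier)
  have "\<phi> \<in> pm_vimage (induced_action S (sigma_class S s)) (proj_D S f)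
      \<longleftrightarrow> \<phi> \<in> proj_D S ((f \<cdot> s)\<^sup>\<star>)" if \<phi>: "\<phi> \<in> proj_D S (s\<^sup>\<star>)" for \<phi>
    using \<phi> f spectral_action_spectrum[OF lu s \<phi>]
    by (auto simp: pm_vimage_def induced_action_eq[OF pr s refl \<phi>] spectral_action_apply[OF \<phi>]
        cyl_def)
  then show ?thesis using sub by blast
qed

end

theorem theorem8p12:
  fixes S :: "('a, 'b) star_semigroup_scheme"
  assumes "restriction_semigroup S"
    and "rs_proper S"
    and "has_local_units S"
  shows "(\<lambda>s. (sigma_class S s, proj_D S (s\<^sup>\<star>\<^bsub>S\<^esub>)))
    \<in> rs_iso S (partial_action_product (sigma_quotient S) (induced_action S)
        (iota (projections S) (smult S)))"
    (is "?\<psi> \<in> rs_iso S ?P")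
proof -
  interpret restriction_semigroup S by fact
  note pr = \<open>rs_proper S\<close> and lu = \<open>has_local_units S\<close>
  have into: "?\<psi> s \<in> carrier ?P" if "s \<in> carrier S" for s
    using that
    by (auto simp: partial_action_product_def quotI iota_def star_proj dom_induced_action)
  \<comment> \<open>Here \<open>f\<close> is the star of \<open>x\<close> and \<open>s\<close> is
    \<open>y\<close>: the intersection in the lemma is then the second component of the
    product.\<close>
  have mult: "?\<psi> (x \<cdot>\<^bsub>S\<^esub> y) = ?\<psi> x \<cdot>\<^bsub>?P\<^esub> ?\<psi> y"
    if "x \<in> carrier S" "y \<in> carrier S" for x y
    using that vimage_induced_action[OF pr lu \<open>y \<in> carrier S\<close> star_proj[OF \<open>x \<in> carrier S\<close>]]
    by (simp add: partial_action_product_def quot_mult flip: star_mult)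
  have star: "?\<psi> (x\<^sup>\<star>\<^bsub>S\<^esub>) = (?\<psi> x)\<^sup>\<star>\<^bsub>?P\<^esub>" if "x \<in> carrier S" for x
    using that by (simp add: partial_action_product_def quot_one[OF star_proj] star_star)
  have "inj_on ?\<psi> (carrier S)"
  proof (rule inj_onI)
    fix x y assume xy: "x \<in> carrier S" "y \<in> carrier S" and eq: "?\<psi> x = ?\<psi> y"
    then have "(x, y) \<in> rs_sigma S" "x\<^sup>\<star>\<^bsub>S\<^esub> = y\<^sup>\<star>\<^bsub>S\<^esub>"
      using inj_onD[OF inj_on_proj_D] by (auto simp: class_eq star_proj)
    then show "x = y" using pr xy by (simp add: rs_proper_def)
  qed
  moreover have "carrier ?P \<subseteq> ?\<psi> ` carrier S"
  proof
    fix p assume "p \<in> carrier ?P"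
    then obtain t e where p: "p = (t, proj_D S e)" and e: "e \<in> projections S"
      and "proj_D S e \<subseteq> dom (induced_action S t)"
      by (auto simp: partial_action_product_def iota_def)
    then obtain s where s: "s \<in> carrier S" "sigma_class S s = t" "e \<cdot>\<^bsub>S\<^esub> s\<^sup>\<star>\<^bsub>S\<^esub> = e"
      using proj_D_subset_dom by blast
    have se: "s \<cdot>\<^bsub>S\<^esub> e \<in> carrier S"
      using s e by (simp add: mult_closed proj_carrier)
    \<comment> \<open>Restricting \<open>s\<close> to \<open>e\<close> cuts its star down to exactly
      \<open>e\<close>, as \<open>e\<close> lies below it; the \<sigma>-class stays \<open>t\<close>
      because \<open>e\<close> is a projection.\<close>
    have "(s \<cdot>\<^bsub>S\<^esub> e)\<^sup>\<star>\<^bsub>S\<^esub> = e"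
      using s e proj_comm[OF e star_proj[of s]] by (simp add: star_mult_proj)
    moreover have "sigma_class S (s \<cdot>\<^bsub>S\<^esub> e) = t"
      using s e se class_eq sigma_mult_proj by blast
    ultimately have "p = ?\<psi> (s \<cdot>\<^bsub>S\<^esub> e)" using p by simp
    then show "p \<in> ?\<psi> ` carrier S" using se by (rule image_eqI)
  qed
  ultimately have "bij_betw ?\<psi> (carrier S) (carrier ?P)"
    using into by (auto simp: bij_betw_def)
  then show ?thesis
    using into mult star unfolding rs_iso_def rs_hom_def by blast
qed

end
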